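(* Let $p\geq 7$ be a prime with $p\equiv 3$ or $7\pmod 8$. Then for all integers $n\geq 0$, \[a_{p-6}\!\left(pn+\frac{13(p^2-1)}{24}\right)\equiv 0\pmod{p}.\] (Here $\frac{13(p^2-1)}{24}$ is an integer since $p\geq 5$ is prime.)
   Context: For a positive integer $m$ and complex $q$ with $|q|<1$, write $f_m=\prod_{k\geq 1}(1-q^{mk})$. For an integer $c\geq 1$, a generalized cubic partition of $n$ is a partition of $n$ whose even parts may each appear in $c$ different colors; $a_c(n)$ denotes the number of such partitions of $n$, with $a_c(0)=1$. Equivalently, $a_c(n)$ is defined by the generating function $\sum_{n\geq 0}a_c(n)q^n=\dfrac{1}{f_1f_2^{\,c-1}}$. *)

theory Defs
  imports Main "HOL-Computational_Algebra.Primes"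
begin

text \<open>A generalized cubic partition of n with c colours: a multiplicity function
  m on pairs (part, colour), where part k \<ge> 1, colour j < 1 if k is odd and
  j < c if k is even, with finitely many nonzero values, and total
  sum of k * m(k,j) equal to n. The pairs with part \<le> n suffice, so we count
  functions supported on that finite set.\<close>

definition gcp_slots :: "nat \<Rightarrow> nat \<Rightarrow> (nat \<times> nat) set" where
  "gcp_slots c n = {(k, j). 1 \<le> k \<and> k \<le> n \<and> j < (if even k then c else 1)}"

definition gcp_count :: "nat \<Rightarrow> nat \<Rightarrow> nat" where
  "gcp_count c n = card {m :: nat \<times> nat \<Rightarrow> nat.
      (\<forall>x. x \<notin> gcp_slots c n \<longrightarrow> m x = 0) \<and>
      (\<Sum>x\<in>gcp_slots c n. fst x * m x) = n}"

end

theory Submission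
  imports Defs "HOL-Computational_Algebra.Formal_Power_Series" "HOL-Number_Theory.Number_Theory"
begin

text \<open>
  Write \<open>f\<^sub>m\<close> for Euler's product in \<open>q\<^sup>m\<close>, \<open>g = f\<^sub>1(q)\<close>, \<open>h = f\<^sub>1(-q)\<close> and \<open>\<theta> = q d/dq\<close>.
  The Wronskian \<open>W = g \<theta>h - h \<theta>g\<close> equals twice \<open>g h\<close> times the odd part of the generating function of \<open>\<sigma>\<close>.
  The four triangular numbers theorem says that this odd part is \<open>q f\<^sub>4\<^sup>8 / f\<^sub>2\<^sup>4\<close>, and
  \<open>g h = f\<^sub>2\<^sup>3 / f\<^sub>4\<close>, so \<open>W f\<^sub>2 = 2 q f\<^sub>4\<^sup>7\<close>. Hence the generating function \<open>A(q)\<close> of the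
  partitions counted with \<open>p - 6\<close> colours satisfies \<open>W = 2 q A(q\<^sup>2) f\<^sub>4\<^sup>p\<close>, and modulo \<open>p\<close> only
  exponents divisible by \<open>p\<close> occur in \<open>f\<^sub>4\<^sup>p\<close>. By the pentagonal number theorem the coefficient of
  \<open>q\<close> to the power \<open>2N + 1\<close> in \<open>W\<close> is a signed sum of differences \<open>j - i\<close> with \<open>24i + 1 = x\<^sup>2\<close>,
  \<open>24j + 1 = y\<^sup>2\<close> and \<open>x\<^sup>2 + y\<^sup>2 = 2 (24N + 13)\<close>. If \<open>p\<close> divides \<open>24N + 13\<close>, then \<open>p \<equiv> 3\<close> modulo 4
  forces \<open>p\<close> to divide \<open>x\<close> and \<open>y\<close>, hence \<open>j - i\<close>.
\<close>

unbundle fps_syntax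

section \<open>Formal power series and Euler's product\<close>

text \<open>This takes the place of convergence: coefficients up to degree N of an infinite product
  depend on finitely many factors, so identities can be checked on finite products.\<close>

definition agree_upto :: "nat \<Rightarrow> int fps \<Rightarrow> int fps \<Rightarrow> bool" where
  "agree_upto N f g \<longleftrightarrow> (\<forall>i\<le>N. f $ i = g $ i)"

lemma agree_upto_refl [simp]: "agree_upto N f f"
  by (simp add: agree_upto_def)

lemma agree_upto_trans [trans]: "agree_upto N f g \<Longrightarrow> agree_upto N g h \<Longrightarrow> agree_upto N f h"
  by (simp add: agree_upto_def)

lemma agree_upto_mult:
  assumes "agree_upto N f f'" "agree_upto N g g'"
  shows "agree_upto N (f * g) (f' * g')"
  using assms by (auto simp: agree_upto_def fps_mult_nth intro!: sum.cong)

lemma agree_upto_power: "agree_upto N f g \<Longrightarrow> agree_upto N (f ^ k) (g ^ k)"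
  by (induction k) (auto intro: agree_upto_mult)

lemma agree_upto_prod:
  "(\<And>x. x \<in> S \<Longrightarrow> agree_upto N (f x) (g x)) \<Longrightarrow> agree_upto N (\<Prod>x\<in>S. f x) (\<Prod>x\<in>S. g x)"
  by (induction S rule: infinite_finite_induct) (auto intro: agree_upto_mult)

lemma fps_nth_compose_X_power:
  fixes f :: "int fps"
  assumes "m > 0"
  shows "(f oo fps_X ^ m) $ n = (if m dvd n then f $ (n div m) else 0)"
proof -
  have "(f oo fps_X ^ m) $ n = (\<Sum>i=0..n. if n = m * i then f $ i else 0)"
    unfolding fps_compose_nth
    by (intro sum.cong) (auto simp flip: power_mult)
  also have "\<dots> = (\<Sum>i\<in>{i\<in>{0..n}. n = m * i}. f $ i)"
    by (rule sum.inter_filter [symmetric]) simp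
  also have "\<dots> = (if m dvd n then f $ (n div m) else 0)"
  proof (cases "m dvd n")
    case True
    then obtain k where "n = m * k" ..
    then have "{i\<in>{0..n}. n = m * i} = {k}" "n div m = k"
      using assms by (auto simp: Suc_leI)
    then show ?thesis using True by simp
  next
    case False
    then have "{i\<in>{0..n}. n = m * i} = {}" by auto
    then show ?thesis using False by (simp only: sum.empty if_False)
  qed
  finally show ?thesis .
qed

section \<open>The operator q d/dq\<close>

definition euler_op :: "int fps \<Rightarrow> int fps" where
  "euler_op f = fps_X * fps_deriv f"

lemma euler_op_nth [simp]: "euler_op f $ n = int n * f $ n"
  by (cases n) (simp_all add: euler_op_def algebra_simps)

lemma euler_op_mult: "euler_op (f * g) = euler_op f * g + f * euler_op g"
  by (simp add: euler_op_def algebra_simps)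

lemma euler_op_compose_X_power:
  assumes "m > 0"
  shows "euler_op (f oo fps_X ^ m) = of_nat m * (euler_op f oo fps_X ^ m)"
proof (rule fps_ext)
  fix n
  show "euler_op (f oo fps_X ^ m) $ n = (of_nat m * (euler_op f oo fps_X ^ m)) $ n"
    using assms
    by (auto simp: fps_nth_compose_X_power fps_of_nat [symmetric] fps_mult_left_const_nth)
qed

lemma euler_op_compose_uminus_X: "euler_op (f oo - fps_X) = euler_op f oo - fps_X"
  by (simp add: fps_eq_iff fps_compose_uminus')

text \<open>Infinite products are compared through their logarithmic derivatives, so that no division by series is needed.\<close>

definition has_log_deriv :: "int fps \<Rightarrow> int fps \<Rightarrow> bool" where
  "has_log_deriv f M \<longleftrightarrow> euler_op f = f * M"

lemma has_log_deriv_mult: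
  "has_log_deriv f M \<Longrightarrow> has_log_deriv g M' \<Longrightarrow> has_log_deriv (f * g) (M + M')"
  by (simp add: has_log_deriv_def euler_op_mult algebra_simps)

lemma has_log_deriv_power:
  "has_log_deriv f M \<Longrightarrow> has_log_deriv (f ^ k) (of_nat k * M)"
proof (induction k)
  case 0
  show ?case by (simp add: has_log_deriv_def euler_op_def)
next
  case (Suc k)
  then show ?case
    using has_log_deriv_mult [OF Suc.prems Suc.IH] by (simp add: algebra_simps)
qed

lemma has_log_deriv_compose_X_power:
  assumes "has_log_deriv f M" "m > 0"
  shows "has_log_deriv (f oo fps_X ^ m) (of_nat m * (M oo fps_X ^ m))"
  using assms
  by (simp add: has_log_deriv_def euler_op_compose_X_power fps_compose_mult_distrib algebra_simps)

lemma has_log_deriv_compose_uminus_X: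
  assumes "has_log_deriv f M"
  shows "has_log_deriv (f oo - fps_X) (M oo - fps_X)"
  using assms
  by (simp add: has_log_deriv_def euler_op_compose_uminus_X fps_compose_mult_distrib)

text \<open>Coefficient n of the defining equation expresses (n - k) f_n through earlier
  coefficients, so everything beyond index k is determined. The case k = 1 serves series that begin
  with \<open>fps_X\<close>.\<close>

lemma has_log_deriv_unique:
  assumes "has_log_deriv f M" "has_log_deriv g M" and M0: "M $ 0 = int k"
    and init: "\<And>i. i \<le> k \<Longrightarrow> f $ i = g $ i"
  shows "f = g"
proof (rule fps_ext)
  fix n
  show "f $ n = g $ n"
  proof (induction n rule: less_induct)
    case (less n)
    show ?case
    proof (cases "n \<le> k")
      case False
      have eq: "int n * h $ n = (\<Sum>i<n. h $ i * M $ (n - i)) + h $ n * int k"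
        if "has_log_deriv h M" for h
      proof -
        have "int n * h $ n = (h * M) $ n"
          using that by (simp add: has_log_deriv_def flip: euler_op_nth)
        also have "\<dots> = (\<Sum>i\<le>n. h $ i * M $ (n - i))"
          by (simp add: fps_mult_nth atLeast0AtMost)
        also have "\<dots> = (\<Sum>i<n. h $ i * M $ (n - i)) + h $ n * int k"
          by (simp add: M0 flip: lessThan_Suc_atMost)
        finally show ?thesis .
      qed
      have "(\<Sum>i<n. f $ i * M $ (n - i)) = (\<Sum>i<n. g $ i * M $ (n - i))"
        using less by (intro sum.cong) auto
      then have "(int n - int k) * f $ n = (int n - int k) * g $ n"
        using eq [OF assms(1)] eq [OF assms(2)] by (simp add: algebra_simps)
      then show ?thesis using False by simp
    qed (use init in auto)
  qed
qed

section \<open>Euler's product and its logarithmic derivative\<close>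

definition geometric :: "nat \<Rightarrow> int fps" where
  "geometric k = Abs_fps (\<lambda>n. if k dvd n then 1 else 0)"

lemma geometric_mult: "k > 0 \<Longrightarrow> (1 - fps_X ^ k) * geometric k = 1"
  by (rule fps_ext)
     (auto simp: geometric_def left_diff_distrib fps_X_power_mult_nth dvd_minus_self
           dest: nat_dvd_not_less)

definition euler_partial :: "nat \<Rightarrow> int fps" where
  "euler_partial K = (\<Prod>k=1..K. 1 - fps_X ^ k)"

text \<open>Reading coefficient n off the product of the first n factors avoids a limit; by
  \<open>euler_partial_nth\<close> later factors do not change it.\<close>

definition euler_fps :: "int fps" where
  "euler_fps = Abs_fps (\<lambda>n. euler_partial n $ n)"

lemma euler_partial_0 [simp]: "euler_partial 0 = 1"
  and euler_partial_Suc: "euler_partial (Suc K) = euler_partial K * (1 - fps_X ^ Suc K)"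
  by (simp_all add: euler_partial_def)

lemma euler_partial_nth: "n \<le> K \<Longrightarrow> euler_partial K $ n = euler_fps $ n"
proof (induction K rule: dec_induct)
  case (step K)
  then show ?case
    by (simp add: euler_partial_Suc right_diff_distrib fps_X_power_mult_right_nth del: power_Suc)
qed (simp add: euler_fps_def)

lemma agree_upto_euler_partial: "N \<le> K \<Longrightarrow> agree_upto N (euler_partial K) euler_fps"
  by (simp add: agree_upto_def euler_partial_nth)

lemma euler_fps_0 [simp]: "euler_fps $ 0 = 1"
  by (simp add: euler_fps_def)

definition sigma :: "nat \<Rightarrow> int" where
  "sigma n = (\<Sum>d | d dvd n. int d)"

definition sigma_fps :: "int fps" where
  "sigma_fps = Abs_fps (\<lambda>n. if n = 0 then 0 else sigma n)"

text \<open>With G the geometric series in X^k, the derivative term -k X^k equals -k (1 - X^k) (G -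
  1).\<close>

lemma has_log_deriv_one_minus_X_power:
  assumes "k > 0"
  shows "has_log_deriv (1 - fps_X ^ k) (- (of_nat k * (geometric k - 1)))"
proof -
  have "(1 - fps_X ^ k) * (geometric k - 1) = fps_X ^ k"
    using geometric_mult [OF assms] by (simp add: algebra_simps)
  moreover have "euler_op (1 - fps_X ^ k) = - (of_nat k * fps_X ^ k)"
    by (rule fps_ext) (auto simp: fps_of_nat [symmetric] fps_mult_left_const_nth)
  ultimately show ?thesis
    unfolding has_log_deriv_def by (simp add: mult.left_commute)
qed

lemma has_log_deriv_euler_partial:
  "has_log_deriv (euler_partial K) (- (\<Sum>k=1..K. of_nat k * (geometric k - 1)))"
proof (induction K)
  case 0
  show ?case by (simp add: has_log_deriv_def euler_op_def)
next
  case (Suc K)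
  then show ?case
    using has_log_deriv_mult [OF Suc has_log_deriv_one_minus_X_power [of "Suc K"]]
    by (simp add: euler_partial_Suc del: power_Suc of_nat_Suc)
qed

lemma sum_geometric_nth:
  assumes "n \<le> K"
  shows "(\<Sum>k=1..K. of_nat k * (geometric k - 1)) $ n = sigma_fps $ n"
proof (cases "n = 0")
  case True
  then show ?thesis
    by (simp add: fps_sum_nth fps_of_nat [symmetric] fps_mult_left_const_nth sigma_fps_def geometric_def)
next
  case False
  have "(\<Sum>k=1..K. of_nat k * (geometric k - 1)) $ n = (\<Sum>k=1..K. if k dvd n then int k else 0)"
    using False
    unfolding fps_sum_nth
    by (intro sum.cong) (auto simp: fps_of_nat [symmetric] fps_mult_left_const_nth geometric_def)
  also have "\<dots> = (\<Sum>k\<in>{k\<in>{1..K}. k dvd n}. int k)"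
    by (rule sum.inter_filter [symmetric]) simp
  also have "{k\<in>{1..K}. k dvd n} = {k. k dvd n}"
    using False assms by (auto dest: dvd_imp_le intro!: Suc_leI Nat.gr0I)
  finally show ?thesis using False by (simp add: sigma_fps_def sigma_def)
qed

text \<open>Coefficient n involves only the first n factors, and their logarithmic derivatives add
  up to a Lambert series whose coefficients are divisor sums.\<close>

lemma has_log_deriv_euler_fps: "has_log_deriv euler_fps (- sigma_fps)"
  unfolding has_log_deriv_def
proof (rule fps_ext)
  fix n
  let ?S = "\<Sum>k=1..n. of_nat k * (geometric k - 1)"
  have "agree_upto n (- ?S) (- sigma_fps)"
    using sum_geometric_nth [of _ n] by (simp add: agree_upto_def)
  then have "agree_upto n (euler_partial n * - ?S) (euler_fps * - sigma_fps)"
    by (intro agree_upto_mult agree_upto_euler_partial order_refl)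
  then have "(euler_fps * - sigma_fps) $ n = euler_op (euler_partial n) $ n"
    using has_log_deriv_euler_partial [of n] unfolding has_log_deriv_def agree_upto_def by simp
  then show "euler_op euler_fps $ n = (euler_fps * - sigma_fps) $ n"
    by (simp add: euler_partial_nth)
qed

section \<open>The pentagonal number theorem and the generating function\<close>

definition triangle :: "nat \<Rightarrow> nat" where
  "triangle s = s * (s + 1) div 2"

lemma triangle_0 [simp]: "triangle 0 = 0"
  by (simp add: triangle_def)

lemma triangle_Suc: "triangle (Suc s) = triangle s + Suc s"
proof -
  have "Suc s * (Suc s + 1) = s * (s + 1) + 2 * Suc s" by (simp add: algebra_simps)
  then show ?thesis unfolding triangle_def by simp
qed

lemma triangle_double: "2 * triangle s = s * (s + 1)"
  by (simp add: triangle_def)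

text \<open>Shanks' finite form of the pentagonal number theorem: only the term \<open>s = 0\<close> contributes to
  coefficients up to \<open>n\<close>, and the sums telescope in \<open>n\<close>.\<close>

definition shanks_term :: "nat \<Rightarrow> nat \<Rightarrow> int fps" where
  "shanks_term n s = (-1) ^ s * (\<Prod>k=Suc s..n. 1 - fps_X ^ k) * fps_X ^ (s * n + triangle s)"

definition shanks_sum :: "nat \<Rightarrow> int fps" where
  "shanks_sum n = (\<Sum>s\<le>n. shanks_term n s)"

text \<open>With m = n + 1 the new exponents are the pentagonal numbers m (3m - 1) / 2 and m (3m +
  1) / 2. The first is what telescoping leaves over, the second is the additional term s = n +
  1.\<close>

lemma shanks_sum_Suc:
  "shanks_sum (Suc n) = shanks_sum n + (-1) ^ Suc n *
     (fps_X ^ (Suc n * Suc n + triangle n) + fps_X ^ (Suc n * Suc n + triangle (Suc n)))"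
proof -
  let ?R = "\<lambda>s. \<Prod>k=Suc s..n. 1 - fps_X ^ k :: int fps"
  \<comment> \<open>Telescoping certificate. Expanding the factor 1 - X^(n+1) of the term for n + 1
    gives two parts: the second is u (s + 1), and the first is the term for n minus u s.\<close>
  define u :: "nat \<Rightarrow> int fps"
    where "u s = (if s = 0 then 0 else (-1) ^ s * ?R (s - 1) * fps_X ^ (s * Suc n + triangle (s - 1)))" for s
  have diff: "shanks_term (Suc n) s - shanks_term n s = u (Suc s) - u s" if "s \<le> n" for s
  proof -
    have R: "(\<Prod>k=Suc s..Suc n. 1 - fps_X ^ k) = ?R s * (1 - fps_X ^ Suc n :: int fps)"
      using that by simp
    have "u (Suc s) = - ((-1) ^ s * ?R s * fps_X ^ (s * Suc n + triangle s) * fps_X ^ Suc n)"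
      by (simp add: u_def algebra_simps power_add)
    moreover have "u s = shanks_term n s - (-1) ^ s * ?R s * fps_X ^ (s * Suc n + triangle s)"
    proof (cases s)
      case 0
      then show ?thesis by (simp add: u_def shanks_term_def)
    next
      case (Suc t)
      have Rt: "?R t = (1 - fps_X ^ s) * ?R s"
        using that Suc by (simp add: prod.atLeast_Suc_atMost del: power_Suc)
      have e: "s * n + triangle s = s * Suc n + triangle t"
        using Suc by (simp add: triangle_Suc)
      have e': "fps_X ^ (s * Suc n + triangle s) = fps_X ^ s * fps_X ^ (s * Suc n + triangle t)"
        unfolding power_add [symmetric] using Suc by (simp add: triangle_Suc algebra_simps)
      have "u s = (-1) ^ s * ?R t * fps_X ^ (s * Suc n + triangle t)"
        using Suc by (simp add: u_def)
      then show ?thesis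
        unfolding shanks_term_def e e' Rt by (simp only: algebra_simps mult_1)
    qed
    ultimately show ?thesis
      unfolding shanks_term_def R by (simp add: algebra_simps)
  qed
  have "(\<Sum>s\<le>n. shanks_term (Suc n) s) - shanks_sum n = (\<Sum>s\<le>n. u (Suc s) - u s)"
    unfolding shanks_sum_def sum_subtractf [symmetric] by (intro sum.cong diff) auto
  also have "\<dots> = u (Suc n) - u 0"
    by (simp only: sum_lessThan_telescope flip: lessThan_Suc_atMost)
  also have "\<dots> = (-1) ^ Suc n * fps_X ^ (Suc n * Suc n + triangle n)"
    by (simp add: u_def)
  finally have "(\<Sum>s\<le>n. shanks_term (Suc n) s) =
    shanks_sum n + (-1) ^ Suc n * fps_X ^ (Suc n * Suc n + triangle n)"
    by (simp only: algebra_simps)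
  moreover have "shanks_term (Suc n) (Suc n) = (-1) ^ Suc n * fps_X ^ (Suc n * Suc n + triangle (Suc n))"
    by (simp add: shanks_term_def)
  ultimately show ?thesis
    by (simp add: shanks_sum_def distrib_left)
qed

text \<open>For i = m (3m - 1) / 2 or m (3m + 1) / 2 the value 24 i + 1 is the square of 6m - 1 or
  6m + 1; m = n + 1 gives the roots 6n + 5 and 6n + 7.\<close>

lemma shanks_sum_support:
  "shanks_sum n $ i \<noteq> 0 \<Longrightarrow> \<exists>x::int. x\<^sup>2 = 24 * int i + 1"
proof (induction n)
  case 0
  then have "i = 0" by (simp add: shanks_sum_def shanks_term_def split: if_splits)
  then show ?case by (intro exI [of _ 1]) simp
next
  case (Suc n)
  have sgn: "((-1) ^ Suc n :: int fps) = 1 \<or> ((-1) ^ Suc n :: int fps) = -1"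
    by (simp only: minus_one_power_iff) simp
  have "shanks_sum n $ i \<noteq> 0 \<or> i = Suc n * Suc n + triangle n \<or> i = Suc n * Suc n + triangle (Suc n)"
    using Suc.prems sgn unfolding shanks_sum_Suc by (auto split: if_splits simp del: power_Suc mult_Suc)
  moreover have "2 * int (triangle n) = int n * (int n + 1)"
    using arg_cong [OF triangle_double [of n], of int] by (simp add: algebra_simps)
  then have "24 * int (Suc n * Suc n + triangle n) + 1 = (6 * int n + 5)\<^sup>2"
    "24 * int (Suc n * Suc n + triangle (Suc n)) + 1 = (6 * int n + 7)\<^sup>2"
    by (simp_all add: triangle_Suc power2_eq_square algebra_simps)
  ultimately show ?case
    using Suc.IH by metis
qed

lemma euler_fps_eq_shanks_sum: "euler_fps $ n = shanks_sum n $ n"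
proof -
  have "shanks_term n s $ n = 0" if s: "s \<in> {1..n}" for s
  proof -
    obtain t where "s = Suc t" using s by (cases s) auto
    then have "n < s * n + triangle s"
      by (simp add: triangle_Suc)
    then show ?thesis
      by (simp add: shanks_term_def fps_X_power_mult_right_nth)
  qed
  then have "(\<Sum>s=1..n. shanks_term n s $ n) = 0"
    by (intro sum.neutral) blast
  then have "shanks_sum n $ n = shanks_term n 0 $ n"
    by (simp add: shanks_sum_def fps_sum_nth sum.atLeast_Suc_atMost flip: atLeast0AtMost)
  also have "\<dots> = euler_fps $ n"
    by (simp add: shanks_term_def euler_fps_def euler_partial_def)
  finally show ?thesis ..
qed

lemma euler_fps_support:
  "euler_fps $ n \<noteq> 0 \<Longrightarrow> \<exists>x::int. x\<^sup>2 = 24 * int n + 1"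
  using shanks_sum_support by (simp add: euler_fps_eq_shanks_sum)

section \<open>Multiplicity functions and products of geometric series\<close>

text \<open>The set counted by \<open>gcp_count\<close>, over an arbitrary weighted index set so
  that induction on that set is possible.\<close>

definition weighted_counts :: "('a \<Rightarrow> nat) \<Rightarrow> 'a set \<Rightarrow> nat \<Rightarrow> ('a \<Rightarrow> nat) set" where
  "weighted_counts w S n = {m. (\<forall>x. x \<notin> S \<longrightarrow> m x = 0) \<and> (\<Sum>x\<in>S. w x * m x) = n}"

lemma weighted_counts_empty:
  "weighted_counts w {} n = (if n = 0 then {\<lambda>_. 0} else {})"
  by (auto simp: weighted_counts_def)

text \<open>The set is fibred by the value k at x; resetting that value to 0 leaves a function
  supported on S with total n - w x * k.\<close>

lemma weighted_counts_insert:
  assumes "finite S" "x \<notin> S"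
  shows "weighted_counts w (insert x S) n =
    (\<Union>k\<in>{k. w x * k \<le> n}. (\<lambda>m. m(x := k)) ` weighted_counts w S (n - w x * k))"
proof (intro equalityI subsetI)
  fix m assume m: "m \<in> weighted_counts w (insert x S) n"
  have upd: "(\<Sum>y\<in>S. w y * (m(x := 0)) y) = (\<Sum>y\<in>S. w y * m y)"
    using assms(2) by (intro sum.cong) auto
  have tot: "w x * m x + (\<Sum>y\<in>S. w y * m y) = n"
    using m assms by (simp add: weighted_counts_def)
  have "m(x := 0) \<in> weighted_counts w S (n - w x * m x)"
    using m upd tot unfolding weighted_counts_def by (auto simp del: fun_upd_apply) simp
  then have "m \<in> (\<lambda>m'. m'(x := m x)) ` weighted_counts w S (n - w x * m x)"
    by (intro image_eqI [where x = "m(x := 0)"]) simp_all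
  then show "m \<in> (\<Union>k\<in>{k. w x * k \<le> n}. (\<lambda>m. m(x := k)) ` weighted_counts w S (n - w x * k))"
    by (rule UN_I [rotated]) (use tot in simp)
next
  fix m assume "m \<in> (\<Union>k\<in>{k. w x * k \<le> n}. (\<lambda>m. m(x := k)) ` weighted_counts w S (n - w x * k))"
  then obtain k m' where k: "w x * k \<le> n" "m' \<in> weighted_counts w S (n - w x * k)" "m = m'(x := k)"
    by auto
  have "(\<Sum>y\<in>S. w y * m y) = (\<Sum>y\<in>S. w y * m' y)"
    using assms(2) k by (intro sum.cong) auto
  then show "m \<in> weighted_counts w (insert x S) n"
    using k assms by (auto simp: weighted_counts_def)
qed

text \<open>By the fibration, adding x to S convolves the counts with the indicator of the multiples
  of w x, which is multiplication by \<open>geometric (w x)\<close>.\<close>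

lemma weighted_counts_generating_function:
  assumes "finite S" "\<And>x. x \<in> S \<Longrightarrow> w x > 0"
  shows "finite (weighted_counts w S n) \<and>
    int (card (weighted_counts w S n)) = (\<Prod>x\<in>S. geometric (w x)) $ n"
  using assms
proof (induction S arbitrary: n rule: finite_induct)
  case empty
  show ?case by (simp add: weighted_counts_empty)
next
  case (insert x S)
  let ?W = "\<lambda>k. (\<lambda>m. m(x := k)) ` weighted_counts w S (n - w x * k)"
  let ?K = "{k. w x * k \<le> n}"
  have wx: "w x > 0" using insert.prems by simp
  have inj_wx: "inj_on ((*) (w x)) ?K" using wx by (auto simp: inj_on_def)
  have IH: "finite (weighted_counts w S j)"
    "int (card (weighted_counts w S j)) = (\<Prod>x\<in>S. geometric (w x)) $ j" for j
    using insert.IH insert.prems by auto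
  \<comment> \<open>A positive weight bounds k by n, so there are finitely many fibres.\<close>
  have "?K \<subseteq> {..n}"
    using wx by (auto intro: order_trans [rotated])
  then have finK: "finite ?K" by (rule finite_subset) simp
  have inj: "inj_on (\<lambda>m. m(x := k)) (weighted_counts w S j)" for k j
  proof (rule inj_onI)
    fix m m' assume "m \<in> weighted_counts w S j" "m' \<in> weighted_counts w S j" "m(x := k) = m'(x := k)"
    moreover from this have "m x = m' x"
      using \<open>x \<notin> S\<close> by (simp add: weighted_counts_def)
    ultimately show "m = m'"
      by (metis fun_upd_triv fun_upd_upd)
  qed
  \<comment> \<open>Fibres for different k are disjoint because their members differ at x.\<close>
  have "card (\<Union>k\<in>?K. ?W k) = (\<Sum>k\<in>?K. card (?W k))"
    using finK IH(1) by (intro card_UN_disjoint) (auto dest!: fun_cong [of _ _ x])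
  also have "\<dots> = (\<Sum>k\<in>?K. card (weighted_counts w S (n - w x * k)))"
    by (intro sum.cong refl card_image inj)
  finally have "int (card (weighted_counts w (insert x S) n)) =
      (\<Sum>k\<in>?K. (\<Prod>x\<in>S. geometric (w x)) $ (n - w x * k))"
    by (simp add: weighted_counts_insert insert.hyps IH(2))
  also have "\<dots> = (\<Sum>i\<in>(*) (w x) ` ?K. (\<Prod>x\<in>S. geometric (w x)) $ (n - i))"
    by (simp add: sum.reindex [OF inj_wx])
  also have "(*) (w x) ` ?K = {i\<in>{0..n}. w x dvd i}"
    by (auto elim!: dvdE)
  also have "(\<Sum>i\<in>{i\<in>{0..n}. w x dvd i}. (\<Prod>x\<in>S. geometric (w x)) $ (n - i)) =
      (\<Sum>i=0..n. if w x dvd i then (\<Prod>x\<in>S. geometric (w x)) $ (n - i) else 0)"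
    by (rule sum.inter_filter) simp
  also have "\<dots> = (\<Prod>x\<in>insert x S. geometric (w x)) $ n"
    using insert.hyps by (auto simp: fps_mult_nth geometric_def intro!: sum.cong)
  finally show ?case
    using finK IH(1) by (simp add: weighted_counts_insert insert.hyps)
qed

section \<open>The generating function of generalized cubic partitions\<close>

lemma gcp_slots_eq_Sigma: "gcp_slots c n = (SIGMA k:{1..n}. {..<if even k then c else 1})"
  by (auto simp: gcp_slots_def)

lemma finite_gcp_slots [simp]: "finite (gcp_slots c n)"
  by (simp add: gcp_slots_eq_Sigma)

definition gcp_fps :: "nat \<Rightarrow> int fps" where
  "gcp_fps c = Abs_fps (\<lambda>n. int (gcp_count c n))"

text \<open>The slot set in \<open>gcp_count c n\<close> varies with n. Passing to the common set
  for N is harmless: the extra slots have parts larger than n, and their geometric series agree with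
  1 up to degree n.\<close>

lemma agree_upto_gcp_fps:
  "agree_upto N (gcp_fps c) (\<Prod>x\<in>gcp_slots c N. geometric (fst x))"
  unfolding agree_upto_def
proof (intro allI impI)
  fix n assume "n \<le> N"
  then have sub: "gcp_slots c n \<subseteq> gcp_slots c N"
    by (auto simp: gcp_slots_def)
  have one: "agree_upto n (geometric (fst x)) 1" if "x \<in> gcp_slots c N - gcp_slots c n" for x
    using that by (auto simp: agree_upto_def geometric_def gcp_slots_def dest: dvd_imp_le)
  have "agree_upto n (\<Prod>x\<in>gcp_slots c N - gcp_slots c n. geometric (fst x)) 1"
    using agree_upto_prod [of "gcp_slots c N - gcp_slots c n" n "\<lambda>x. geometric (fst x)" "\<lambda>_. 1"] one
    by auto
  then have "agree_upto n ((\<Prod>x\<in>gcp_slots c N - gcp_slots c n. geometric (fst x)) *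
      (\<Prod>x\<in>gcp_slots c n. geometric (fst x))) (1 * (\<Prod>x\<in>gcp_slots c n. geometric (fst x)))"
    by (intro agree_upto_mult) auto
  also have "(\<Prod>x\<in>gcp_slots c N - gcp_slots c n. geometric (fst x)) *
      (\<Prod>x\<in>gcp_slots c n. geometric (fst x)) = (\<Prod>x\<in>gcp_slots c N. geometric (fst x))"
    by (rule prod.subset_diff [OF sub finite_gcp_slots, symmetric])
  finally have "(\<Prod>x\<in>gcp_slots c N. geometric (fst x)) $ n =
      (\<Prod>x\<in>gcp_slots c n. geometric (fst x)) $ n"
    by (simp add: agree_upto_def)
  moreover have "int (card (weighted_counts fst (gcp_slots c n) n)) =
      (\<Prod>x\<in>gcp_slots c n. geometric (fst x)) $ n"
    by (rule weighted_counts_generating_function [OF finite_gcp_slots, THEN conjunct2])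
       (auto simp: gcp_slots_def)
  ultimately show "gcp_fps c $ n = (\<Prod>x\<in>gcp_slots c N. geometric (fst x)) $ n"
    by (simp add: gcp_fps_def gcp_count_def weighted_counts_def)
qed

lemma agree_upto_euler_compose_square:
  "agree_upto N (\<Prod>k\<in>{k\<in>{1..N}. even k}. 1 - fps_X ^ k) (euler_fps oo fps_X ^ 2)"
proof -
  have "(\<Prod>k\<in>{k\<in>{1..N}. even k}. 1 - fps_X ^ k) = (\<Prod>k=1..N div 2. 1 - fps_X ^ (2 * k) :: int fps)"
    by (rule prod.reindex_bij_witness [of _ "\<lambda>k. 2 * k" "\<lambda>k. k div 2"]) auto
  also have "\<dots> = euler_partial (N div 2) oo fps_X ^ 2"
    by (simp add: euler_partial_def fps_compose_prod_distrib fps_compose_sub_distrib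
          fps_X_power_compose flip: power_mult)
  also have "agree_upto N \<dots> (euler_fps oo fps_X ^ 2)"
    by (auto simp: agree_upto_def fps_nth_compose_X_power euler_partial_nth div_le_mono)
  finally show ?thesis .
qed

text \<open>The generating function 1 / (f_1 f_2^(c-1)), written without division.\<close>

lemma gcp_fps_mult:
  assumes "c > 0"
  shows "gcp_fps c * (euler_fps * (euler_fps oo fps_X ^ 2) ^ (c - 1)) = 1"
proof (rule fps_ext)
  fix N
  let ?G = "\<Prod>x\<in>gcp_slots c N. geometric (fst x)"
  let ?E = "\<Prod>k\<in>{k\<in>{1..N}. even k}. 1 - fps_X ^ k :: int fps"
  have "(\<Prod>x\<in>gcp_slots c N. 1 - fps_X ^ fst x :: int fps) =
      (\<Prod>(k, j)\<in>(SIGMA k:{1..N}. {..<if even k then c else 1}). 1 - fps_X ^ k)"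
    by (simp only: gcp_slots_eq_Sigma case_prod_unfold)
  also have "\<dots> = (\<Prod>k=1..N. \<Prod>j<if even k then c else 1. 1 - fps_X ^ k)"
    by (rule prod.Sigma [symmetric]) auto
  also have "\<dots> = (\<Prod>k=1..N. (1 - fps_X ^ k) ^ (if even k then c else 1))"
    by simp
  \<comment> \<open>One factor for every k assembles f_1; the c - 1 remaining factors for even k
    assemble the power of f_2.\<close>
  also have "\<dots> = (\<Prod>k=1..N. (1 - fps_X ^ k) * (if even k then (1 - fps_X ^ k) ^ (c - 1) else 1))"
    using assms by (intro prod.cong) (auto simp flip: power_Suc)
  also have "\<dots> = euler_partial N * ?E ^ (c - 1)"
    by (simp add: prod.distrib euler_partial_def prod_power_distrib prod.inter_filter [symmetric])
  finally have slots: "(\<Prod>x\<in>gcp_slots c N. 1 - fps_X ^ fst x) = euler_partial N * ?E ^ (c - 1)" .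
  have "(\<Prod>x\<in>gcp_slots c N. (1 - fps_X ^ fst x) * geometric (fst x)) = 1"
    by (intro prod.neutral) (auto simp: gcp_slots_def intro: geometric_mult)
  then have "?G * (euler_partial N * ?E ^ (c - 1)) = 1"
    unfolding slots [symmetric] by (simp add: prod.distrib mult.commute)
  moreover have "agree_upto N (gcp_fps c * (euler_fps * (euler_fps oo fps_X ^ 2) ^ (c - 1)))
      (?G * (euler_partial N * ?E ^ (c - 1)))"
    using agree_upto_euler_partial [of N N] agree_upto_euler_compose_square [of N]
    by (intro agree_upto_mult agree_upto_power agree_upto_gcp_fps) (auto simp: agree_upto_def)
  ultimately show "(gcp_fps c * (euler_fps * (euler_fps oo fps_X ^ 2) ^ (c - 1))) $ N = 1 $ N"
    by (simp add: agree_upto_def)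
qed

section \<open>Liouville's method and the four triangular numbers theorem\<close>

text \<open>Here a and b are divisors of i = a x and of M - i = b y, so sums of a b over these
  quadruples are convolutions of divisor sums.\<close>

definition quads :: "nat \<Rightarrow> (nat \<times> nat \<times> nat \<times> nat) set" where
  "quads M = {(a, b, x, y). 0 < a \<and> 0 < b \<and> 0 < x \<and> 0 < y \<and> a * x + b * y = M}"

lemma finite_quads [simp]: "finite (quads M)"
proof (rule finite_subset)
  have "a \<le> M \<and> b \<le> M \<and> x \<le> M \<and> y \<le> M" if "0 < a" "0 < b" "0 < x" "0 < y" "a * x + b * y = M"
    for a b x y :: nat
  proof -
    have "a \<le> a * x" "x \<le> a * x" "b \<le> b * y" "y \<le> b * y" using that by auto
    then show ?thesis using that(5) by linarith
  qed
  then show "quads M \<subseteq> {..M} \<times> {..M} \<times> {..M} \<times> {..M}"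
    unfolding quads_def by blast
qed simp

definition quad_sum :: "nat \<Rightarrow> (nat \<Rightarrow> nat \<Rightarrow> nat \<Rightarrow> nat \<Rightarrow> bool) \<Rightarrow> (nat \<Rightarrow> nat \<Rightarrow> int) \<Rightarrow> int" where
  "quad_sum M P f = (\<Sum>(a, b, x, y)\<in>{(a, b, x, y)\<in>quads M. P a b x y}. f a b)"

lemma finite_quads_filter [simp]: "finite {(a, b, x, y)\<in>quads M. P a b x y}"
  by (rule finite_subset [of _ "quads M"]) auto

lemma quad_sum_cong:
  assumes "\<And>a b x y. 0 < a \<Longrightarrow> 0 < b \<Longrightarrow> 0 < x \<Longrightarrow> 0 < y \<Longrightarrow> a * x + b * y = M \<Longrightarrow> P a b x y = Q a b x y"
  shows "quad_sum M P f = quad_sum M Q f"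
proof -
  have "{(a, b, x, y)\<in>quads M. P a b x y} = {(a, b, x, y)\<in>quads M. Q a b x y}"
    using assms by (auto simp: quads_def)
  then show ?thesis by (simp add: quad_sum_def)
qed

lemma quad_sum_split:
  "quad_sum M P f = quad_sum M (\<lambda>a b x y. P a b x y \<and> Q a b x y) f
     + quad_sum M (\<lambda>a b x y. P a b x y \<and> \<not> Q a b x y) f"
  unfolding quad_sum_def
  by (subst sum.union_disjoint [symmetric]) (auto intro!: sum.cong)

lemma quad_sum_diff: "quad_sum M P f - quad_sum M P g = quad_sum M P (\<lambda>a b. f a b - g a b)"
  by (simp add: quad_sum_def sum_subtractf [symmetric] case_prod_unfold)

lemma quad_sum_const_mult: "quad_sum M P (\<lambda>a b. c * f a b) = c * quad_sum M P f"
  by (simp add: quad_sum_def sum_distrib_left case_prod_unfold)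

text \<open>Liouville's bijections come from \<open>a x + b y = a (x - y) + (a + b) y\<close>, combined with exchanging the
  two products so that the larger coefficient always ends up in the second place.\<close>

lemma quad_sum_plus_square:
  assumes "odd M"
  shows "quad_sum M (\<lambda>a b x y. even a \<and> even x = e \<and> x \<noteq> y) (\<lambda>a b. (int a + int b)\<^sup>2)
       = quad_sum M (\<lambda>a b x y. odd b \<and> even x \<noteq> e \<and> a < b) (\<lambda>a b. (int b)\<^sup>2)"
  unfolding quad_sum_def
\<comment> \<open>The second map goes forward, the first is its inverse. As M is odd and a even, b
  and y are odd; hence the parity of the first coefficient of the image tells which case produced
  it, and the parity of x is flipped.\<close>
proof (rule sum.reindex_bij_witness [of _
    "\<lambda>(a, b, x, y). if even a then (a, b - a, x + y, y) else (b - a, a, y, x + y)"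
    "\<lambda>(a, b, x, y). if y < x then (a, a + b, x - y, y) else (b, a + b, y - x, x)"], goal_cases)
  case (1 t)
  then show ?case using assms by (cases t) (auto simp: quads_def)
next
  case (2 t)
  obtain a b x y where t: "t = (a, b, x, y)" by (cases t)
  have "a * x + b * y = M" "even a" "even x = e" "x \<noteq> y" "0 < a" "0 < b" "0 < x" "0 < y"
    using 2 t by (auto simp: quads_def)
  moreover from this have "odd b" "odd y" using assms by auto
  moreover have "a * y + (a * x + b * y - a * y) = a * x + b * y" if "y < x"
    using mult_le_mono2 [of y x a] that by linarith
  ultimately show ?case unfolding t
    by (cases "y < x") (auto simp: quads_def algebra_simps diff_mult_distrib2)
next
  case (3 t)
  then show ?case by (cases t) (auto simp: quads_def)
next
  case (4 t)
  obtain a b x y where t: "t = (a, b, x, y)" by (cases t)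
  have h: "a * x + b * y = M" "odd b" "even x \<noteq> e" "a < b" "0 < a" "0 < b" "0 < x" "0 < y"
    using 4 t by (auto simp: quads_def)
  then have "even a \<longrightarrow> odd y" "odd a \<longrightarrow> odd x = even y" using assms by auto
  then show ?case unfolding t using h
    by (cases "even a") (auto simp: quads_def algebra_simps diff_mult_distrib)
next
  case (5 t)
  then show ?case by (cases t) (auto simp: add.commute)
qed

text \<open>The substitution runs the other way: a x + b y = a (x + y) + (b - a) y if a < b, with
  the products exchanged if b < a. Equality is impossible since a is even and b odd.\<close>

lemma quad_sum_minus_square:
  assumes "odd M"
  shows "quad_sum M (\<lambda>a b x y. even a \<and> even x = e) (\<lambda>a b. (int a - int b)\<^sup>2)
       = quad_sum M (\<lambda>a b x y. odd b \<and> even x \<noteq> e \<and> y < x) (\<lambda>a b. (int b)\<^sup>2)"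
  unfolding quad_sum_def
proof (rule sum.reindex_bij_witness [of _
    "\<lambda>(a, b, x, y). if even a then (a, a + b, x - y, y) else (a + b, a, y, x - y)"
    "\<lambda>(a, b, x, y). if a < b then (a, b - a, x + y, y) else (b, a - b, x + y, x)"], goal_cases)
  case (1 t)
  then show ?case using assms by (cases t) (auto simp: quads_def)
next
  case (2 t)
  obtain a b x y where t: "t = (a, b, x, y)" by (cases t)
  have h: "a * x + b * y = M" "even a" "even x = e" "0 < a" "0 < b" "0 < x" "0 < y"
    using 2 t by (auto simp: quads_def)
  then have o: "odd b" "odd y" using assms by auto
  then have "a \<noteq> b" using h by auto
  then show ?case unfolding t using h o
    by (cases "a < b") (auto simp: quads_def algebra_simps diff_mult_distrib)
next
  case (3 t)
  then show ?case using assms by (cases t) (auto simp: quads_def)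
next
  case (4 t)
  obtain a b x y where t: "t = (a, b, x, y)" by (cases t)
  have h: "a * x + b * y = M" "odd b" "even x \<noteq> e" "y < x" "0 < a" "0 < b" "0 < x" "0 < y"
    using 4 t by (auto simp: quads_def)
  then have "even a \<longrightarrow> odd y" "odd a \<longrightarrow> odd x = even y" using assms by auto
  moreover have "a * y + (a * x + b * y - a * y) = a * x + b * y"
    using mult_le_mono2 [of y x a] h by linarith
  ultimately show ?case unfolding t using h
    by (cases "even a") (auto simp: quads_def algebra_simps diff_mult_distrib2)
next
  case (5 t)
  obtain a b x y where t: "t = (a, b, x, y)" by (cases t)
  have h: "a * x + b * y = M" "even a" "even x = e" "0 < a" "0 < b" "0 < x" "0 < y"
    using 5 t by (auto simp: quads_def)
  then have o: "odd b" "odd y" using assms by auto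
  then have "a \<noteq> b" using h by auto
  then show ?case unfolding t
    by (cases "a < b") (auto simp: of_nat_diff power2_commute)
qed

text \<open>The substitution a x + b y = (a - b) x + b (x + y) keeps b and x, hence the summand and
  the parity conditions.\<close>

lemma quad_sum_second_square:
  "quad_sum M (\<lambda>a b x y. odd b \<and> even x = e \<and> b < a) (\<lambda>a b. (int b)\<^sup>2)
   = quad_sum M (\<lambda>a b x y. odd b \<and> even x = e \<and> x < y) (\<lambda>a b. (int b)\<^sup>2)"
  unfolding quad_sum_def
proof (rule sum.reindex_bij_witness [of _
    "\<lambda>(a, b, x, y). (a + b, b, x, y - x)" "\<lambda>(a, b, x, y). (a - b, b, x, x + y)"], goal_cases)
  case (2 t)
  then show ?case
    by (cases t) (auto simp: quads_def algebra_simps diff_mult_distrib)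
next
  case (4 t)
  then show ?case
    by (cases t) (auto simp: quads_def algebra_simps diff_mult_distrib2)
qed (auto simp: quads_def)

text \<open>Write 4 a b = (a + b)^2 - (a - b)^2. The bijections turn both squares into sums of b^2,
  restricted to a < b and to y < x. Splitting the unrestricted sum by a against b and by x against
  y, the parts b < a and x < y cancel by \<open>quad_sum_second_square\<close>, and only diagonal
  terms remain.\<close>

lemma quad_sum_even_product:
  assumes "odd M"
  shows "4 * quad_sum M (\<lambda>a b x y. even a \<and> even x = e) (\<lambda>a b. int a * int b)
       = quad_sum M (\<lambda>a b x y. even a \<and> even x = e \<and> x = y) (\<lambda>a b. (int a + int b)\<^sup>2)
       + quad_sum M (\<lambda>a b x y. odd b \<and> even x \<noteq> e \<and> x = y) (\<lambda>a b. (int b)\<^sup>2)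
       - quad_sum M (\<lambda>a b x y. odd b \<and> even x \<noteq> e \<and> a = b) (\<lambda>a b. (int b)\<^sup>2)"
proof -
  let ?sq = "\<lambda>a b. (int b)\<^sup>2"
  let ?P = "\<lambda>a b x y. odd b \<and> even x \<noteq> e"
  have trich_b: "quad_sum M ?P ?sq = quad_sum M (\<lambda>a b x y. odd b \<and> even x \<noteq> e \<and> a < b) ?sq
      + (quad_sum M (\<lambda>a b x y. odd b \<and> even x \<noteq> e \<and> b < a) ?sq
      + quad_sum M (\<lambda>a b x y. odd b \<and> even x \<noteq> e \<and> a = b) ?sq)"
    unfolding quad_sum_split [of M ?P _ "\<lambda>a b x y. a < b"]
      quad_sum_split [of M "\<lambda>a b x y. (odd b \<and> even x \<noteq> e) \<and> \<not> a < b" _ "\<lambda>a b x y. b < a"]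
    by (intro arg_cong2 [where f = "(+)"] quad_sum_cong) auto
  have trich_x: "quad_sum M ?P ?sq = quad_sum M (\<lambda>a b x y. odd b \<and> even x \<noteq> e \<and> y < x) ?sq
      + (quad_sum M (\<lambda>a b x y. odd b \<and> even x \<noteq> e \<and> x < y) ?sq
      + quad_sum M (\<lambda>a b x y. odd b \<and> even x \<noteq> e \<and> x = y) ?sq)"
    unfolding quad_sum_split [of M ?P _ "\<lambda>a b x y. y < x"]
      quad_sum_split [of M "\<lambda>a b x y. (odd b \<and> even x \<noteq> e) \<and> \<not> y < x" _ "\<lambda>a b x y. x < y"]
    by (intro arg_cong2 [where f = "(+)"] quad_sum_cong) auto
  have "4 * quad_sum M (\<lambda>a b x y. even a \<and> even x = e) (\<lambda>a b. int a * int b)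
      = quad_sum M (\<lambda>a b x y. even a \<and> even x = e) (\<lambda>a b. (int a + int b)\<^sup>2)
      - quad_sum M (\<lambda>a b x y. even a \<and> even x = e) (\<lambda>a b. (int a - int b)\<^sup>2)"
    unfolding quad_sum_diff quad_sum_const_mult [symmetric]
    by (simp add: power2_eq_square algebra_simps)
  also have "quad_sum M (\<lambda>a b x y. even a \<and> even x = e) (\<lambda>a b. (int a + int b)\<^sup>2)
      = quad_sum M (\<lambda>a b x y. even a \<and> even x = e \<and> x = y) (\<lambda>a b. (int a + int b)\<^sup>2)
      + quad_sum M (\<lambda>a b x y. even a \<and> even x = e \<and> x \<noteq> y) (\<lambda>a b. (int a + int b)\<^sup>2)"
    unfolding quad_sum_split [of M "\<lambda>a b x y. even a \<and> even x = e" _ "\<lambda>a b x y. x = y"]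
    by (simp add: conj_assoc)
  finally show ?thesis
    using trich_b trich_x quad_sum_second_square [of M "\<not> e"]
    unfolding quad_sum_plus_square [OF assms] quad_sum_minus_square [OF assms]
    by simp
qed

section \<open>The diagonal terms as divisor sums\<close>

text \<open>If x = y, the equation reads (a + b) x = M, so d = a + b runs through the divisors of
  M.\<close>

lemma quad_sum_equal_factors:
  assumes "odd M"
  shows "quad_sum M (\<lambda>a b x y. odd b \<and> x = y) f = (\<Sum>d | d dvd M. \<Sum>b | b < d \<and> odd b. f (d - b) b)"
proof -
  have "M > 0" using assms by (intro odd_pos)
  have "quad_sum M (\<lambda>a b x y. odd b \<and> x = y) f
      = (\<Sum>(d, b)\<in>(SIGMA d:{d. d dvd M}. {b. b < d \<and> odd b}). f (d - b) b)"
    unfolding quad_sum_def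
  proof (rule sum.reindex_bij_witness [of _ "\<lambda>(d, b). (d - b, b, M div d, M div d)"
        "\<lambda>(a, b, x, y). (a + b, b)"], goal_cases)
    case (1 t)
    then show ?case
      by (cases t) (auto simp: quads_def simp flip: add_mult_distrib)
  next
    case (2 t)
    then show ?case
      by (cases t) (auto simp: quads_def odd_pos simp flip: add_mult_distrib)
  next
    case (3 t)
    then show ?case by (cases t) auto
  next
    case (4 t)
    then show ?case using \<open>M > 0\<close>
      by (cases t) (auto simp: quads_def odd_pos div_greater_zero_iff dvd_imp_le dvd_pos_nat simp flip: add_mult_distrib)
  next
    case (5 t)
    then show ?case by (cases t) auto
  qed
  also have "\<dots> = (\<Sum>d | d dvd M. \<Sum>b | b < d \<and> odd b. f (d - b) b)"
    using \<open>M > 0\<close> by (intro sum.Sigma [symmetric]) auto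
  finally show ?thesis .
qed

text \<open>If a = b = d, the equation reads d (x + y) = M, so x runs through the positive numbers
  below M / d.\<close>

lemma quad_sum_equal_coefficients:
  assumes "odd M"
  shows "quad_sum M (\<lambda>a b x y. odd b \<and> P x \<and> a = b) f
    = (\<Sum>d | d dvd M. \<Sum>x | 0 < x \<and> x < M div d \<and> P x. f d d)"
proof -
  have "M > 0" using assms by (intro odd_pos)
  have "quad_sum M (\<lambda>a b x y. odd b \<and> P x \<and> a = b) f
      = (\<Sum>(d, x)\<in>(SIGMA d:{d. d dvd M}. {x. 0 < x \<and> x < M div d \<and> P x}). f d d)"
    unfolding quad_sum_def
  proof (rule sum.reindex_bij_witness [of _ "\<lambda>(d, x). (d, d, x, M div d - x)"
        "\<lambda>(a, b, x, y). (a, x)"], goal_cases)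
    case (1 t)
    then show ?case
      by (cases t) (auto simp: quads_def simp flip: add_mult_distrib2)
  next
    case (2 t)
    then show ?case
      by (cases t) (auto simp: quads_def simp flip: add_mult_distrib2)
  next
    case (3 t)
    then show ?case by (cases t) auto
  next
    case (4 t)
    then show ?case using \<open>M > 0\<close> assms
      by (cases t) (auto simp: quads_def dvd_pos_nat simp flip: add_mult_distrib2)
  next
    case (5 t)
    then show ?case by (cases t) auto
  qed
  also have "\<dots> = (\<Sum>d | d dvd M. \<Sum>x | 0 < x \<and> x < M div d \<and> P x. f d d)"
    using \<open>M > 0\<close> by (intro sum.Sigma [symmetric]) auto
  finally show ?thesis .
qed

lemma odd_less_Suc_double: "{b. b < Suc (2 * k) \<and> odd b} = (\<lambda>j. Suc (2 * j)) ` {..<k}"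
  by (auto elim!: oddE)

lemma even_less_Suc_double: "{x. 0 < x \<and> x < Suc (2 * k) \<and> even x} = (\<lambda>j. 2 * Suc j) ` {..<k}"
proof (intro equalityI subsetI)
  fix x assume "x \<in> {x. 0 < x \<and> x < Suc (2 * k) \<and> even x}"
  then have "x = 2 * Suc (x div 2 - 1)" "x div 2 - 1 < k" by (auto elim!: evenE)
  then show "x \<in> (\<lambda>j. 2 * Suc j) ` {..<k}" by blast
qed auto

lemma card_odd_less: "odd d \<Longrightarrow> 2 * int (card {b. b < d \<and> odd b}) = int d - 1"
  by (auto elim!: oddE simp: odd_less_Suc_double card_image inj_on_def)

lemma card_even_less: "odd d \<Longrightarrow> 2 * int (card {x. 0 < x \<and> x < d \<and> even x}) = int d - 1"
  by (auto elim!: oddE simp: even_less_Suc_double card_image inj_on_def)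

lemma sum_odd_squares_less:
  assumes "odd d"
  shows "6 * (\<Sum>b | b < d \<and> odd b. (int b)\<^sup>2) = int d * (int d - 1) * (int d - 2)"
proof -
  obtain k where k: "d = Suc (2 * k)" using assms by (auto elim!: oddE)
  have "6 * (\<Sum>j<k. (2 * int j + 1)\<^sup>2) = (2 * int k + 1) * (2 * int k) * (2 * int k - 1)"
    by (induction k) (simp_all add: power2_eq_square algebra_simps)
  then show ?thesis
    unfolding k odd_less_Suc_double by (simp add: sum.reindex inj_on_def algebra_simps)
qed

text \<open>Both parities of x in \<open>quad_sum_even_product\<close> give divisor sums. The
  weights 4 and -12 are those for which the terms d^3 and d^2 cancel and a multiple of the sum of d
  survives.\<close>

lemma quad_sum_sigma:
  assumes "odd M"
  shows "4 * quad_sum M (\<lambda>a b x y. even a \<and> odd x) (\<lambda>a b. int a * int b)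
    - 12 * quad_sum M (\<lambda>a b x y. even a \<and> even x) (\<lambda>a b. int a * int b)
    = (int M - 1) * sigma M"
proof -
  let ?sq = "\<lambda>a b. (int b)\<^sup>2"
  define D where "D = (\<Sum>d | d dvd M. \<Sum>b | b < d \<and> odd b. (int d)\<^sup>2)"
  define C where "C = (\<Sum>d | d dvd M. \<Sum>b | b < d \<and> odd b. (int b)\<^sup>2)"
  define E where "E = (\<Sum>d | d dvd M. \<Sum>x | 0 < x \<and> x < M div d \<and> odd x. (int d)\<^sup>2)"
  define E' where "E' = (\<Sum>d | d dvd M. \<Sum>x | 0 < x \<and> x < M div d \<and> even x. (int d)\<^sup>2)"
  have odd_dvd: "odd d" if "d dvd M" for d
    using dvd_trans [of 2 d M] that assms by blast
  have zero: "quad_sum M P f = 0"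
    if "\<And>a b x y. a * x + b * y = M \<Longrightarrow> \<not> P a b x y" for P f
    unfolding quad_sum_def using that by (intro sum.neutral) (auto simp: quads_def)
  \<comment> \<open>If x = y, then (a + b) x is odd. This makes parity conditions redundant in some
    diagonal sums and empties those that ask for even x or for even a with odd sum condition
    violated.\<close>
  have par: "a * x + b * x = M \<Longrightarrow> odd x \<and> even a = odd b" for a b x
    using assms by auto
  have "quad_sum M (\<lambda>a b x y. even a \<and> even x = False \<and> x = y) (\<lambda>a b. (int a + int b)\<^sup>2)
      = quad_sum M (\<lambda>a b x y. odd b \<and> x = y) (\<lambda>a b. (int a + int b)\<^sup>2)"
    by (rule quad_sum_cong) (use par in auto)
  also have "\<dots> = D"
    unfolding D_def quad_sum_equal_factors [OF assms] by (intro sum.cong) auto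
  finally have D: "quad_sum M (\<lambda>a b x y. even a \<and> even x = False \<and> x = y) (\<lambda>a b. (int a + int b)\<^sup>2) = D" .
  have "quad_sum M (\<lambda>a b x y. odd b \<and> even x \<noteq> True \<and> x = y) ?sq
      = quad_sum M (\<lambda>a b x y. odd b \<and> x = y) ?sq"
    by (rule quad_sum_cong) (use par in auto)
  also have "\<dots> = C"
    unfolding C_def quad_sum_equal_factors [OF assms] ..
  finally have C: "quad_sum M (\<lambda>a b x y. odd b \<and> even x \<noteq> True \<and> x = y) ?sq = C" .
  have E: "quad_sum M (\<lambda>a b x y. odd b \<and> even x \<noteq> True \<and> a = b) ?sq = E"
    "quad_sum M (\<lambda>a b x y. odd b \<and> even x \<noteq> False \<and> a = b) ?sq = E'"
    unfolding quad_sum_equal_coefficients [OF assms] E_def E'_def by simp_all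
  have "4 * quad_sum M (\<lambda>a b x y. even a \<and> even x = True) (\<lambda>a b. int a * int b) = 0 + C - E"
    unfolding quad_sum_even_product [OF assms] C E
    by (subst zero) (use par in auto)
  then have even: "4 * quad_sum M (\<lambda>a b x y. even a \<and> even x) (\<lambda>a b. int a * int b) = C - E"
    by simp
  have "4 * quad_sum M (\<lambda>a b x y. even a \<and> even x = False) (\<lambda>a b. int a * int b) = D + 0 - E'"
    unfolding quad_sum_even_product [OF assms] D E
    by (subst zero) (use par in auto)
  then have odd: "4 * quad_sum M (\<lambda>a b x y. even a \<and> odd x) (\<lambda>a b. int a * int b) = D - E'"
    by simp
  \<comment> \<open>M / d is odd, so odd and even positive numbers below it are equally many; this
    gives E' = E.\<close>
  have counts: "2 * int (card {x. 0 < x \<and> x < M div d \<and> odd x}) = int (M div d) - 1"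
    "2 * int (card {x. 0 < x \<and> x < M div d \<and> even x}) = int (M div d) - 1" if "d dvd M" for d
  proof -
    have "odd (M div d)" using odd_dvd that by (metis dvd_div_mult_self dvd_triv_left)
    moreover have "{x. 0 < x \<and> x < M div d \<and> odd x} = {x. x < M div d \<and> odd x}"
      by (auto simp: odd_pos)
    ultimately show "2 * int (card {x. 0 < x \<and> x < M div d \<and> odd x}) = int (M div d) - 1"
      "2 * int (card {x. 0 < x \<and> x < M div d \<and> even x}) = int (M div d) - 1"
      using card_odd_less card_even_less by simp_all
  qed
  have prod: "int d * int (M div d) = int M" if "d dvd M" for d
    using that by (simp flip: of_nat_mult)
  have "2 * E = (\<Sum>d | d dvd M. int M * int d - (int d)\<^sup>2)"
    unfolding E_def sum_distrib_left sum_constant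
  proof (intro sum.cong refl, goal_cases)
    case (1 d)
    have "2 * (int (card {x. 0 < x \<and> x < M div d \<and> odd x}) * (int d)\<^sup>2)
        = (2 * int (card {x. 0 < x \<and> x < M div d \<and> odd x})) * (int d)\<^sup>2"
      by (rule mult.assoc [symmetric])
    also have "\<dots> = (int d * int (M div d)) * int d - (int d)\<^sup>2"
      using counts(1) [of d] 1 by (simp only: mem_Collect_eq) (simp add: algebra_simps power2_eq_square)
    finally show ?case using 1 prod by simp
  qed
  moreover have "E' = E"
    unfolding E_def E'_def sum_constant
  proof (intro sum.cong refl, goal_cases)
    case (1 d)
    then show ?case using counts [of d] by simp
  qed
  moreover have "2 * D = (\<Sum>d | d dvd M. (int d - 1) * (int d)\<^sup>2)"
    unfolding D_def sum_distrib_left sum_constant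
    by (intro sum.cong refl) (simp only: mult.assoc [symmetric] mem_Collect_eq card_odd_less odd_dvd not_False_eq_True)
  moreover have "6 * C = (\<Sum>d | d dvd M. int d * (int d - 1) * (int d - 2))"
    unfolding C_def sum_distrib_left
    by (intro sum.cong refl) (use sum_odd_squares_less odd_dvd in \<open>simp add: sum_distrib_left\<close>)
  \<comment> \<open>With E' = E, the required combination (D - E') - 3 (C - E) is D + 2 E - 3
    C.\<close>
  ultimately have "2 * (D + 2 * E - 3 * C) = (\<Sum>d | d dvd M. (int d - 1) * (int d)\<^sup>2
      + 2 * (int M * int d - (int d)\<^sup>2) - int d * (int d - 1) * (int d - 2))"
    by (simp add: sum.distrib sum_subtractf flip: sum_distrib_left)
  also have "\<dots> = (\<Sum>d | d dvd M. 2 * (int M - 1) * int d)"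
    by (intro sum.cong) (simp_all add: algebra_simps power2_eq_square)
  also have "\<dots> = 2 * ((int M - 1) * sigma M)"
    unfolding sigma_def sum_distrib_left by (simp only: mult.assoc)
  finally show ?thesis
    using even odd \<open>E' = E\<close> by simp
qed

section \<open>Convolutions of divisor sums\<close>

text \<open>The even divisors of i are the doubles of the divisors of i / 2.\<close>

lemma sum_even_divisors:
  assumes "i > 0"
  shows "(\<Sum>a | a dvd i \<and> even a. int a) = 2 * (sigma_fps oo fps_X ^ 2) $ i"
proof (cases "even i")
  case True
  then obtain j where j: "i = 2 * j" by (elim evenE)
  have "{a. a dvd i \<and> even a} = (*) 2 ` {a. a dvd j}"
  proof (intro equalityI subsetI)
    fix a assume a: "a \<in> {a. a dvd i \<and> even a}"
    then have "even a" by simp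
    then obtain c where "a = 2 * c" by (elim evenE)
    with a j show "a \<in> (*) 2 ` {a. a dvd j}" by simp
  qed (use j in auto)
  then show ?thesis
    using assms j
    by (simp add: fps_nth_compose_X_power sigma_fps_def sigma_def sum.reindex inj_on_def sum_distrib_left)
next
  case False
  then have empty: "{a. a dvd i \<and> even a} = {}" using dvd_trans [of 2 _ i] by blast
  show ?thesis unfolding empty using False by (simp add: fps_nth_compose_X_power)
qed

text \<open>If a and i / a are both even, then a is twice a divisor of i / 4.\<close>

lemma sum_even_even_divisors:
  assumes "i > 0"
  shows "(\<Sum>a | a dvd i \<and> even a \<and> even (i div a). int a) = 2 * (sigma_fps oo fps_X ^ 4) $ i"
proof (cases "4 dvd i")
  case True
  then obtain j where j: "i = 4 * j" ..
  have "{a. a dvd i \<and> even a \<and> even (i div a)} = (*) 2 ` {a. a dvd j}"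
  proof (intro equalityI subsetI)
    fix a assume a: "a \<in> {a. a dvd i \<and> even a \<and> even (i div a)}"
    then obtain b where b: "i = a * b" by blast
    with a assms have "even b" by simp
    then obtain e where e: "b = 2 * e" by (elim evenE)
    from a have "even a" by simp
    then obtain c where c: "a = 2 * c" by (elim evenE)
    have "j = c * e" using b j c e by simp
    then have "a = 2 * c" "c dvd j" using c by simp_all
    then show "a \<in> (*) 2 ` {a. a dvd j}" by blast
  next
    fix a assume "a \<in> (*) 2 ` {a. a dvd j}"
    then obtain c where "a = 2 * c" "c dvd j" by blast
    moreover from this obtain e where "j = c * e" by (elim dvdE)
    ultimately have "i = a * (2 * e)" "a = 2 * c" using j by simp_all
    then show "a \<in> {a. a dvd i \<and> even a \<and> even (i div a)}"
      using assms by simp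
  qed
  then show ?thesis
    using assms j
    by (simp add: fps_nth_compose_X_power sigma_fps_def sigma_def sum.reindex inj_on_def sum_distrib_left)
next
  case False
  have "4 dvd i" if "a dvd i" "even a" "even (i div a)" for a
    using mult_dvd_mono [OF that(2,3)] that(1) by simp
  then have empty: "{a. a dvd i \<and> even a \<and> even (i div a)} = {}" using False by blast
  show ?thesis unfolding empty using False by (simp add: fps_nth_compose_X_power)
qed

text \<open>Group the quadruples by i = a x: then x = i / a, and b is any divisor of M - i.\<close>

lemma quad_sum_product:
  "quad_sum M (\<lambda>a b x y. P a x) (\<lambda>a b. int a * int b)
    = (\<Sum>i\<in>{0<..<M}. (\<Sum>a | a dvd i \<and> P a (i div a). int a) * sigma (M - i))"
proof -
  have "quad_sum M (\<lambda>a b x y. P a x) (\<lambda>a b. int a * int b) =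
    (\<Sum>(i, a, b)\<in>(SIGMA i:{0<..<M}. {a. a dvd i \<and> P a (i div a)} \<times> {b. b dvd M - i}). int a * int b)"
    unfolding quad_sum_def
  proof (rule sum.reindex_bij_witness [of _ "\<lambda>(i, a, b). (a, b, i div a, (M - i) div b)"
        "\<lambda>(a, b, x, y). (a * x, a, b)"], goal_cases)
    case (1 t)
    then show ?case by (cases t) (auto simp: quads_def)
  next
    case (2 t)
    then show ?case by (cases t) (auto simp: quads_def)
  next
    case (3 t)
    then show ?case by (cases t) auto
  next
    case (4 t)
    then show ?case
      by (cases t) (auto simp: quads_def div_greater_zero_iff dvd_imp_le dvd_pos_nat intro!: Nat.gr0I)
  next
    case (5 t)
    then show ?case by (cases t) auto
  qed
  also have "\<dots> = (\<Sum>i\<in>{0<..<M}. \<Sum>(a, b)\<in>{a. a dvd i \<and> P a (i div a)} \<times> {b. b dvd M - i}. int a * int b)"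
    by (rule sum.Sigma [symmetric]) auto
  also have "\<dots> = (\<Sum>i\<in>{0<..<M}. (\<Sum>a | a dvd i \<and> P a (i div a). int a) * sigma (M - i))"
    by (simp add: sigma_def sum_product sum.cartesian_product)
  finally show ?thesis .
qed

definition odd_sigma_fps :: "int fps" where
  "odd_sigma_fps = Abs_fps (\<lambda>n. if odd n then sigma n else 0)"

text \<open>For odd M and even i the argument M - i is odd, so \<open>sigma\<close> may be replaced
  by its odd part.\<close>

lemma convolution_odd_sigma:
  assumes "odd M" and even: "\<And>i. g $ i \<noteq> 0 \<Longrightarrow> even i" and "g $ 0 = 0"
  shows "(\<Sum>i\<in>{0<..<M}. 2 * g $ i * sigma (M - i)) = 2 * (g * odd_sigma_fps) $ M"
proof -
  have "(g * odd_sigma_fps) $ M = (\<Sum>i=0..M. g $ i * odd_sigma_fps $ (M - i))"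
    by (rule fps_mult_nth)
  also have "\<dots> = (\<Sum>i\<in>{0<..<M}. g $ i * odd_sigma_fps $ (M - i))"
    using assms(3) by (intro sum.mono_neutral_right) (auto simp: odd_sigma_fps_def le_less)
  also have "\<dots> = (\<Sum>i\<in>{0<..<M}. g $ i * sigma (M - i))"
  proof (intro sum.cong refl)
    fix i assume "i \<in> {0<..<M}"
    then show "g $ i * odd_sigma_fps $ (M - i) = g $ i * sigma (M - i)"
      using even [of i] \<open>odd M\<close> by (auto simp: odd_sigma_fps_def)
  qed
  finally show ?thesis by (simp add: sum_distrib_left mult.assoc)
qed

text \<open>At odd M this is \<open>quad_sum_sigma\<close> read as a recurrence for sigma on odd
  numbers; at even M both sides vanish.\<close>

lemma has_log_deriv_odd_sigma_fps:
  "has_log_deriv odd_sigma_fps (1 + 8 * (sigma_fps oo fps_X ^ 2) - 32 * (sigma_fps oo fps_X ^ 4))"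
  unfolding has_log_deriv_def
proof (rule fps_ext)
  fix M
  let ?L2 = "sigma_fps oo fps_X ^ 2" and ?L4 = "sigma_fps oo fps_X ^ 4"
  have even: "even i" if "?L2 $ i \<noteq> 0 \<or> ?L4 $ i \<noteq> 0" for i
    using that by (auto simp: fps_nth_compose_X_power split: if_splits intro: dvd_trans [of 2 4])
  have rhs: "(odd_sigma_fps * (1 + 8 * ?L2 - 32 * ?L4)) $ M
      = odd_sigma_fps $ M + 8 * (?L2 * odd_sigma_fps) $ M - 32 * (?L4 * odd_sigma_fps) $ M"
    unfolding mult.commute [of odd_sigma_fps] distrib_right left_diff_distrib mult.assoc
    by (simp add: numeral_fps_const)
  show "euler_op odd_sigma_fps $ M = (odd_sigma_fps * (1 + 8 * ?L2 - 32 * ?L4)) $ M"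
  proof (cases "even M")
    case True
    have "(g * odd_sigma_fps) $ M = 0" if "\<And>i. g $ i \<noteq> 0 \<Longrightarrow> even i" for g
      unfolding fps_mult_nth using that True by (intro sum.neutral) (auto simp: odd_sigma_fps_def)
    then show ?thesis unfolding rhs using even True by (simp add: odd_sigma_fps_def)
  next
    case False
    have "quad_sum M (\<lambda>a b x y. even a) (\<lambda>a b. int a * int b) = 2 * (?L2 * odd_sigma_fps) $ M"
      using False even
      by (subst convolution_odd_sigma [symmetric])
         (auto simp: quad_sum_product sum_even_divisors sigma_fps_def intro!: sum.cong)
    moreover have "quad_sum M (\<lambda>a b x y. even a \<and> even x) (\<lambda>a b. int a * int b) = 2 * (?L4 * odd_sigma_fps) $ M"
      using False even
      by (subst convolution_odd_sigma [symmetric])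
         (auto simp: quad_sum_product sum_even_even_divisors sigma_fps_def intro!: sum.cong)
    \<comment> \<open>Replacing the sum over odd x by a difference turns the weights 4 and -12 into
      4 and -16; the factor 2 in each convolution makes them 8 and -32.\<close>
    moreover have "quad_sum M (\<lambda>a b x y. even a) (\<lambda>a b. int a * int b)
        = quad_sum M (\<lambda>a b x y. even a \<and> even x) (\<lambda>a b. int a * int b)
        + quad_sum M (\<lambda>a b x y. even a \<and> odd x) (\<lambda>a b. int a * int b)"
      by (rule quad_sum_split)
    ultimately show ?thesis
      unfolding rhs using quad_sum_sigma [of M] False by (simp add: odd_sigma_fps_def algebra_simps)
  qed
qed

text \<open>That is, \<open>\<sigma>(2k) = 3 \<sigma>(k) - 2 \<sigma>(k/2)\<close>, where the last term is absent for odd \<open>k\<close>.\<close>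

lemma sigma_fps_parity:
  "sigma_fps + (sigma_fps oo - fps_X) + 4 * (sigma_fps oo fps_X ^ 4) = 6 * (sigma_fps oo fps_X ^ 2)"
proof (rule fps_ext)
  fix n
  let ?e = "\<lambda>i. \<Sum>a | a dvd i \<and> even a. int a"
  let ?L2 = "sigma_fps oo fps_X ^ 2" and ?L4 = "sigma_fps oo fps_X ^ 4"
  have "2 * sigma_fps $ n + 4 * ?L4 $ n = 6 * ?L2 $ n" if "even n" "n > 0"
  proof -
    obtain k where k: "n = 2 * k" "k > 0" using \<open>even n\<close> \<open>n > 0\<close> by (auto elim!: evenE)
    have split: "sigma i = ?e i + (\<Sum>a | a dvd i \<and> odd a. int a)" if "i > 0" for i
      unfolding sigma_def using that
      by (subst sum.union_disjoint [symmetric]) (auto intro!: sum.cong)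
    \<comment> \<open>The odd divisors of n = 2k and of k coincide, so only the even divisors
      contribute to the difference of the two divisor sums.\<close>
    have "{a. a dvd n \<and> odd a} = {a. a dvd k \<and> odd a}"
      using k by (auto simp: coprime_dvd_mult_right_iff)
    moreover have "?L4 $ n = ?L2 $ k"
      using k by (auto simp: fps_nth_compose_X_power elim!: dvdE)
    moreover have "?L2 $ n = sigma k" using k by (simp add: fps_nth_compose_X_power sigma_fps_def)
    ultimately show ?thesis
      using split [of n] split [of k] sum_even_divisors [of n] sum_even_divisors [of k] k
      by (simp add: sigma_fps_def)
  qed
  moreover have "?L2 $ n = 0 \<and> ?L4 $ n = 0" if "odd n"
    using that by (auto simp: fps_nth_compose_X_power intro: dvd_trans [of 2 4])
  ultimately show "(sigma_fps + (sigma_fps oo - fps_X) + 4 * ?L4) $ n = (6 * ?L2) $ n"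
    by (cases "n = 0"; cases "even n")
       (simp_all add: fps_compose_uminus' numeral_fps_const sigma_fps_def)
qed

section \<open>The Wronskian and the congruence\<close>

lemma fps_compose_X_power_X_power:
  fixes f :: "int fps"
  assumes "m > 0" "n > 0"
  shows "(f oo fps_X ^ m) oo fps_X ^ n = f oo fps_X ^ (m * n)"
proof (rule fps_ext)
  fix i
  have "m * n dvd i \<longleftrightarrow> n dvd i \<and> m dvd i div n"
    using assms by (auto simp: mult.commute elim!: dvdE)
  then show "((f oo fps_X ^ m) oo fps_X ^ n) $ i = (f oo fps_X ^ (m * n)) $ i"
    using assms by (simp add: fps_nth_compose_X_power div_mult2_eq mult.commute [of m])
qed

text \<open>Differentiating \<open>f ^ p\<close> produces a factor \<open>p\<close> and multiplies the coefficients by their index.\<close>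

lemma fps_power_prime_nth_dvd:
  fixes f :: "int fps"
  assumes "prime p" "\<not> p dvd i"
  shows "int p dvd (f ^ p) $ i"
proof -
  have "euler_op (f ^ p) = of_nat p * (fps_X * (fps_deriv f * f ^ (p - 1)))"
    by (simp add: euler_op_def fps_deriv_power' mult.left_commute mult.assoc)
  then have "int i * (f ^ p) $ i = int p * (fps_X * (fps_deriv f * f ^ (p - 1))) $ i"
    by (simp add: fps_of_nat [symmetric] fps_mult_left_const_nth flip: euler_op_nth)
  then have "int p dvd int i * (f ^ p) $ i" by simp
  then show ?thesis
    using assms by (simp add: prime_dvd_mult_iff)
qed

lemma euler_fps_log_deriv_compose_X_power:
  "m > 0 \<Longrightarrow> has_log_deriv (euler_fps oo fps_X ^ m) (- (of_nat m * (sigma_fps oo fps_X ^ m)))"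
  using has_log_deriv_compose_X_power [OF has_log_deriv_euler_fps] by (simp add: fps_compose_uminus)

lemma fps_compose_X_power_nth_0 [simp]: "m > 0 \<Longrightarrow> ((f::int fps) oo fps_X ^ m) $ 0 = f $ 0"
  by (simp add: fps_nth_compose_X_power)

text \<open>By \<open>sigma_fps_parity\<close> both sides have the same logarithmic derivative, and
  both have constant term 1.\<close>

lemma euler_fps_compose_uminus_X:
  "euler_fps * (euler_fps oo - fps_X) * (euler_fps oo fps_X ^ 4) = (euler_fps oo fps_X ^ 2) ^ 3"
proof (rule has_log_deriv_unique [where k = 0])
  have "has_log_deriv (euler_fps * (euler_fps oo - fps_X) * (euler_fps oo fps_X ^ 4))
      (- sigma_fps + (- sigma_fps oo - fps_X) + - (of_nat 4 * (sigma_fps oo fps_X ^ 4)))"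
    by (intro has_log_deriv_mult has_log_deriv_euler_fps has_log_deriv_compose_uminus_X
        euler_fps_log_deriv_compose_X_power) simp
  moreover have "- sigma_fps + (- sigma_fps oo - fps_X) + - (of_nat 4 * (sigma_fps oo fps_X ^ 4))
      = of_nat 3 * - (of_nat 2 * (sigma_fps oo fps_X ^ 2))"
    using sigma_fps_parity by (simp add: fps_compose_uminus algebra_simps)
  ultimately show "has_log_deriv (euler_fps * (euler_fps oo - fps_X) * (euler_fps oo fps_X ^ 4))
      (of_nat 3 * - (of_nat 2 * (sigma_fps oo fps_X ^ 2)))"
    by (simp only:)
  show "has_log_deriv ((euler_fps oo fps_X ^ 2) ^ 3) (of_nat 3 * - (of_nat 2 * (sigma_fps oo fps_X ^ 2)))"
    by (intro has_log_deriv_power euler_fps_log_deriv_compose_X_power) simp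
qed (simp_all add: sigma_fps_def fps_power_zeroth)

text \<open>The four triangular numbers theorem: multiplying by f_2^4 removes the term in q^2 from
  the logarithmic derivative, leaving that of q f_4^8.\<close>

lemma odd_sigma_fps_product:
  "odd_sigma_fps * (euler_fps oo fps_X ^ 2) ^ 4 = fps_X * (euler_fps oo fps_X ^ 4) ^ 8"
proof (rule has_log_deriv_unique)
  let ?L2 = "sigma_fps oo fps_X ^ 2" and ?L4 = "sigma_fps oo fps_X ^ 4"
  have "has_log_deriv (odd_sigma_fps * (euler_fps oo fps_X ^ 2) ^ 4)
      (1 + 8 * ?L2 - 32 * ?L4 + of_nat 4 * - (of_nat 2 * ?L2))"
    by (intro has_log_deriv_mult has_log_deriv_odd_sigma_fps has_log_deriv_power
        euler_fps_log_deriv_compose_X_power) simp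
  then show "has_log_deriv (odd_sigma_fps * (euler_fps oo fps_X ^ 2) ^ 4) (1 - 32 * ?L4)"
    by (simp add: algebra_simps)
  have "has_log_deriv fps_X 1"
    by (simp add: has_log_deriv_def euler_op_def)
  then have "has_log_deriv (fps_X * (euler_fps oo fps_X ^ 4) ^ 8) (1 + of_nat 8 * - (of_nat 4 * ?L4))"
    by (intro has_log_deriv_mult has_log_deriv_power euler_fps_log_deriv_compose_X_power) simp_all
  then show "has_log_deriv (fps_X * (euler_fps oo fps_X ^ 4) ^ 8) (1 - 32 * ?L4)"
    by simp
  \<comment> \<open>The constant term is 1, so the coefficients at 0 and 1 must both be
    compared.\<close>
  show "(1 - 32 * ?L4) $ 0 = int 1"
    by (simp add: numeral_fps_const sigma_fps_def)
  show "(odd_sigma_fps * (euler_fps oo fps_X ^ 2) ^ 4) $ i = (fps_X * (euler_fps oo fps_X ^ 4) ^ 8) $ i"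
    if "i \<le> 1" for i
    using that
    by (cases i) (simp_all add: fps_mult_nth odd_sigma_fps_def sigma_def fps_power_zeroth)
qed

definition euler_wronskian :: "int fps" where
  "euler_wronskian = euler_fps * euler_op (euler_fps oo - fps_X) - (euler_fps oo - fps_X) * euler_op euler_fps"

lemma euler_wronskian_product:
  "euler_wronskian * (euler_fps oo fps_X ^ 2) = 2 * fps_X * (euler_fps oo fps_X ^ 4) ^ 7"
proof -
  let ?g = euler_fps and ?h = "euler_fps oo - fps_X"
  let ?F2 = "euler_fps oo fps_X ^ 2" and ?F4 = "euler_fps oo fps_X ^ 4"
  have "sigma_fps - (sigma_fps oo - fps_X) = 2 * odd_sigma_fps"
    by (rule fps_ext) (simp add: fps_compose_uminus' sigma_fps_def odd_sigma_fps_def numeral_fps_const odd_pos)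
  moreover have "euler_op ?g = ?g * - sigma_fps" "euler_op ?h = ?h * (- sigma_fps oo - fps_X)"
    using has_log_deriv_euler_fps has_log_deriv_compose_uminus_X [OF has_log_deriv_euler_fps]
    by (simp_all only: has_log_deriv_def)
  then have "euler_wronskian = ?g * ?h * (sigma_fps - (sigma_fps oo - fps_X))"
    by (simp add: euler_wronskian_def fps_compose_uminus algebra_simps)
  \<comment> \<open>The factors f_2^4 and f_4 let both product identities apply; afterwards the
    nonzero series f_2^3 f_4 is cancelled.\<close>
  ultimately have "euler_wronskian * ?F2 ^ 4 * ?F4 = 2 * (?g * ?h * ?F4) * (odd_sigma_fps * ?F2 ^ 4)"
    by (simp add: mult_ac)
  also have "\<dots> = 2 * ?F2 ^ 3 * (fps_X * ?F4 ^ 8)"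
    by (simp only: euler_fps_compose_uminus_X odd_sigma_fps_product)
  finally have "(euler_wronskian * ?F2) * (?F2 ^ 3 * ?F4) = (2 * fps_X * ?F4 ^ 7) * (?F2 ^ 3 * ?F4)"
    by (simp add: eval_nat_numeral mult_ac)
  moreover have "?F2 $ 0 \<noteq> 0" "?F4 $ 0 \<noteq> 0" by simp_all
  then have "?F2 \<noteq> 0" "?F4 \<noteq> 0" by (metis fps_zero_nth)+
  ultimately show ?thesis by (metis mult_cancel_right no_zero_divisors power_not_zero)
qed

text \<open>For c = p - 6 the generating function in q^2 is inverse to f_2 f_4^(p-7). This exponent
  is exactly what completes f_4^7 in \<open>euler_wronskian_product\<close> to a p-th power.\<close>

lemma gcp_fps_euler_wronskian:
  assumes "p \<ge> 7"
  shows "2 * fps_X * (gcp_fps (p - 6) oo fps_X ^ 2) * (euler_fps oo fps_X ^ 4) ^ p = euler_wronskian"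
proof -
  let ?A = "gcp_fps (p - 6) oo fps_X ^ 2"
  let ?F2 = "euler_fps oo fps_X ^ 2" and ?F4 = "euler_fps oo fps_X ^ 4"
  have "gcp_fps (p - 6) * (euler_fps * ?F2 ^ (p - 7)) = 1"
    using gcp_fps_mult [of "p - 6"] assms by simp
  then have "(gcp_fps (p - 6) * (euler_fps * ?F2 ^ (p - 7))) oo fps_X ^ 2 = 1"
    by simp
  then have one: "?A * (?F2 * ?F4 ^ (p - 7)) = 1"
    by (simp add: fps_compose_mult_distrib fps_compose_power [symmetric] fps_compose_X_power_X_power)
  have "?F4 ^ p = ?F4 ^ 7 * ?F4 ^ (p - 7)"
    using assms by (simp flip: power_add)
  then have "2 * fps_X * ?A * ?F4 ^ p = ?A * ?F4 ^ (p - 7) * (2 * fps_X * ?F4 ^ 7)"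
    by (simp add: mult_ac)
  also have "\<dots> = euler_wronskian * (?A * (?F2 * ?F4 ^ (p - 7)))"
    unfolding euler_wronskian_product [symmetric] by (simp add: mult_ac)
  finally show ?thesis by (simp add: one)
qed

section \<open>Divisibility of the coefficients by p\<close>

text \<open>Otherwise x^2 and -y^2 are congruent units; raising them to the odd power (p - 1) / 2
  yields 1 = -1 modulo p by Fermat.\<close>

lemma prime_3_mod_4_dvd_sum_squares:
  fixes x y :: int
  assumes p: "prime p" "p mod 4 = 3" and dvd: "int p dvd x\<^sup>2 + y\<^sup>2"
  shows "int p dvd x \<and> int p dvd y"
proof (rule ccontr)
  assume contra: "\<not> ?thesis"
  have prime: "prime (int p)" using p by simp
  have "int p dvd x\<^sup>2 \<longleftrightarrow> int p dvd y\<^sup>2"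
    using dvd by (metis dvd_add_left_iff dvd_add_right_iff)
  then have ndvd: "\<not> int p dvd x" "\<not> int p dvd y"
    using contra prime by (auto simp: prime_dvd_power_iff)
  define k where "k = p div 4"
  have pk: "p - 1 = 2 * (2 * k + 1)"
    unfolding k_def using p(2) by presburger
  have fermat: "[(z\<^sup>2) ^ (2 * k + 1) = 1] (mod int p)" if "\<not> int p dvd z" for z
  proof -
    have "\<not> p dvd nat \<bar>z\<bar>" using that by (simp add: int_dvd_int_iff [symmetric])
    then have "[nat \<bar>z\<bar> ^ (p - 1) = 1] (mod p)" using p(1) by (rule fermat_theorem [rotated])
    then have "[int (nat \<bar>z\<bar> ^ (p - 1)) = int 1] (mod int p)" by (simp only: cong_int_iff)
    moreover have "int (nat \<bar>z\<bar> ^ (p - 1)) = (z\<^sup>2) ^ (2 * k + 1)"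
      by (simp only: pk power_mult of_nat_power abs_ge_zero nat_0_le power2_abs)
    ultimately show ?thesis by simp
  qed
  have "[x\<^sup>2 = - (y\<^sup>2)] (mod int p)"
    using dvd by (simp add: cong_iff_dvd_diff)
  then have "[(x\<^sup>2) ^ (2 * k + 1) = (- (y\<^sup>2)) ^ (2 * k + 1)] (mod int p)"
    by (rule cong_pow)
  moreover have "(- (y\<^sup>2)) ^ (2 * k + 1) = - ((y\<^sup>2) ^ (2 * k + 1))"
    by (rule power_minus_odd) simp
  ultimately have "[1 = - 1] (mod int p)"
    using fermat [OF ndvd(1)] fermat [OF ndvd(2)]
    by (metis cong_minus_minus_iff cong_sym cong_trans)
  then have "p dvd 2"
    by (simp add: cong_iff_dvd_diff flip: int_dvd_int_iff)
  then have "p \<le> 2" by (rule dvd_imp_le) simp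
  then show False using p(2) by (auto simp: le_Suc_eq numeral_2_eq_2)
qed

lemma euler_wronskian_nth_dvd:
  assumes p: "prime p" "p \<ge> 7" "p mod 4 = 3" and N: "p dvd 24 * N + 13"
  shows "int p dvd euler_wronskian $ (2 * N + 1)"
proof -
  let ?c = "\<lambda>i. euler_fps $ i" and ?n = "2 * N + 1"
  have term_dvd: "int p dvd ?c i * ?c j * (int j - int i)" if "i + j = ?n" for i j
  proof (cases "?c i = 0 \<or> ?c j = 0")
    case False
    then obtain x y :: int where xy: "x\<^sup>2 = 24 * int i + 1" "y\<^sup>2 = 24 * int j + 1"
      using euler_fps_support by blast
    have "int i + int j = 2 * int N + 1" using that by linarith
    \<comment> \<open>24 (i + j) + 2 = 48 N + 26.\<close>
    then have "x\<^sup>2 + y\<^sup>2 = 2 * int (24 * N + 13)" using xy by simp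
    then have "int p dvd x\<^sup>2 + y\<^sup>2" using N by (simp only: dvd_mult int_dvd_int_iff)
    then have "int p dvd x" "int p dvd y"
      using prime_3_mod_4_dvd_sum_squares [OF p(1,3)] by blast+
    then have "int p dvd y\<^sup>2 - x\<^sup>2" by (simp add: power2_eq_square)
    then have "int p dvd 24 * (int j - int i)" unfolding xy by simp
    moreover have "\<not> int p dvd 24"
    proof
      assume "int p dvd 24"
      then have "p dvd 2 ^ 3 * 3" by (simp flip: int_dvd_int_iff)
      then have "p dvd 2 \<or> p dvd 3"
        using p(1) by (metis prime_dvd_mult_iff prime_dvd_power)
      then show False using p(2) by (auto dest: dvd_imp_le)
    qed
    ultimately have "int p dvd int j - int i"
      using p(1) prime_dvd_mult_iff [of "int p" 24 "int j - int i"] by simp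
    then show ?thesis by (rule dvd_mult)
  qed auto
  \<comment> \<open>After commuting, both products carry index i on the undisturbed variable and the
    sign on n - i, so their convolutions combine termwise.\<close>
  have flip: "((euler_fps oo - fps_X) * euler_op euler_fps) = (euler_op euler_fps * (euler_fps oo - fps_X))"
    by (rule mult.commute)
  have "euler_wronskian $ ?n = (\<Sum>i=0..?n. (-1) ^ (?n - i) * (?c i * ?c (?n - i) * (int (?n - i) - int i)))"
    unfolding euler_wronskian_def flip fps_sub_nth fps_mult_nth sum_subtractf [symmetric]
    by (intro sum.cong) (simp_all add: fps_compose_uminus' algebra_simps)
  also have "int p dvd \<dots>"
    by (intro dvd_sum dvd_mult term_dvd) auto
  finally show ?thesis .
qed

text \<open>Strong induction replaces division by the p-th power F modulo p: in coefficient 2N + 1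
  of F B every term except the one with index 0 in F is divisible by p, and so is the whole
  coefficient.\<close>

lemma gcp_count_dvd:
  assumes p: "prime p" "p \<ge> 7" "p mod 4 = 3" and N: "p dvd 24 * N + 13"
  shows "int p dvd gcp_fps (p - 6) $ N"
  using N
proof (induction N rule: less_induct)
  case (less N)
  define F where "F = (euler_fps oo fps_X ^ 4) ^ p"
  define B where "B = 2 * fps_X * (gcp_fps (p - 6) oo fps_X ^ 2)"
  let ?n = "2 * N + 1"
  have B_nth: "B $ (2 * M + 1) = 2 * gcp_fps (p - 6) $ M" "B $ (2 * M) = 0" for M
    by (simp_all add: B_def mult.assoc numeral_fps_const fps_nth_compose_X_power)
  have "int p dvd F $ i * B $ (?n - i)" if i: "i \<in> {1..?n}" for i
  proof (cases "p dvd i")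
    case False
    then show ?thesis unfolding F_def using fps_power_prime_nth_dvd [OF p(1)] by (intro dvd_mult2)
  next
    case True
    show ?thesis
    proof (cases "even i")
      case True
      then obtain j where j: "i = 2 * j" by (elim evenE)
      have "j \<le> N" "j > 0" using i j by auto
      \<comment> \<open>Lowering N by j changes 24 N + 13 by 12 i, a multiple of p, so the induction
        hypothesis applies.\<close>
      have "24 * N + 13 = (24 * (N - j) + 13) + 12 * i" using \<open>j \<le> N\<close> j by simp
      then have "p dvd 24 * (N - j) + 13"
        using less.prems \<open>p dvd i\<close> by (simp only: dvd_add_left_iff dvd_mult)
      then have "int p dvd gcp_fps (p - 6) $ (N - j)"
        using less.IH [of "N - j"] \<open>j > 0\<close> \<open>j \<le> N\<close> by simp
      moreover have "?n - i = 2 * (N - j) + 1" using \<open>j \<le> N\<close> j by simp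
      ultimately show ?thesis by (simp only: B_nth dvd_mult)
    next
      case False
      \<comment> \<open>For odd i the index in B is even, where B vanishes.\<close>
      then obtain j where "i = 2 * j + 1" by (elim oddE)
      then have "?n - i = 2 * (N - j)" by simp
      then show ?thesis by (simp only: B_nth mult_zero_right dvd_0_right)
    qed
  qed
  then have "int p dvd (\<Sum>i=1..?n. F $ i * B $ (?n - i))"
    by (intro dvd_sum) blast
  moreover have "euler_wronskian $ ?n = F $ 0 * B $ (?n - 0) + (\<Sum>i=1..?n. F $ i * B $ (?n - i))"
    unfolding gcp_fps_euler_wronskian [OF p(2), symmetric] B_def [symmetric] F_def [symmetric]
      mult.commute [of B] fps_mult_nth
    by (simp add: sum.atLeast_Suc_atMost)
  moreover have "int p dvd euler_wronskian $ ?n"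
    using euler_wronskian_nth_dvd [OF p less.prems] .
  ultimately have "int p dvd F $ 0 * B $ (?n - 0)"
    by (simp only: dvd_add_left_iff)
  moreover have "F $ 0 = 1" by (simp add: F_def fps_power_zeroth)
  ultimately have "int p dvd 2 * gcp_fps (p - 6) $ N"
    by (simp only: diff_zero B_nth mult_1)
  moreover have "\<not> int p dvd 2"
    using p(2) by (auto dest: zdvd_imp_le)
  ultimately show ?case
    using p(1) prime_dvd_mult_iff [of "int p" 2] by simp
qed

theorem theorem3p2:
  fixes p n :: nat
  assumes "prime p" and "p \<ge> 7" and "p mod 8 = 3 \<or> p mod 8 = 7"
  shows "gcp_count (p - 6) (p * n + (13 * (p^2 - 1)) div 24) mod p = 0"
proof -
  have p4: "p mod 4 = 3" using assms(3) by presburger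
  have "p mod 3 \<noteq> 0"
    using assms(1,2) by (auto simp: prime_nat_iff dvd_eq_mod_eq_0)
  then have "p mod 3 = 1 \<or> p mod 3 = 2" by presburger
  then have "p\<^sup>2 mod 3 = 1" by (auto simp: power2_eq_square mod_mult_eq [symmetric, of p p])
  moreover have "p\<^sup>2 mod 8 = 1"
    using assms(3) by (auto simp: power2_eq_square mod_mult_eq [symmetric, of p p])
  ultimately have "24 dvd p\<^sup>2 - 1" by presburger
  then obtain r where r: "p\<^sup>2 - 1 = 24 * r" ..
  have "p\<^sup>2 > 0" using assms(2) by simp
  with r have "p\<^sup>2 = 24 * r + 1" by linarith
  \<comment> \<open>13 (24 r + 1) = 13 p^2 supplies the factor p.\<close>
  then have "24 * (p * n + 13 * r) + 13 = p * (24 * n + 13 * p)"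
    by (simp add: algebra_simps power2_eq_square)
  then have "p dvd 24 * (p * n + 13 * r) + 13" by simp
  then have "int p dvd gcp_fps (p - 6) $ (p * n + 13 * r)"
    by (rule gcp_count_dvd [OF assms(1,2) p4])
  then have "p dvd gcp_count (p - 6) (p * n + 13 * r)"
    by (simp add: gcp_fps_def int_dvd_int_iff)
  moreover have "(13 * (p\<^sup>2 - 1)) div 24 = 13 * r"
    unfolding r by simp
  ultimately show ?thesis by (simp add: dvd_eq_mod_eq_0)
qed

end
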